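(* Let $f : [-1,1]^2 \to \mathbb{R}$ be a $\mathcal{C}^2$ function that has a critical point at the origin (i.e. $\nabla f(0,0)=0$) and is such that neither $f(0,\cdot)$ nor $f(\cdot,0)$ is a constant function, and let $C < +\infty$ be such that for every $x,y \in [-1,1]$, $$f(x,y) - \inf_{x' \in [-1,1]} f(x',y) \le C\, |\partial_x f(x,y)|^2 \quad\text{and}\quad \sup_{y' \in [-1,1]} f(x,y') - f(x,y) \le C\, |\partial_y f(x,y)|^2.$$ Then there exists $r > 0$ such that for every $z(0) \in B_r$, the gradient descent-ascent flow $(z(t))_{t\ge 0}$ of $f$ started from $z(0)$ converges to the origin as $t \to +\infty$.
   Context: $B_r$ denotes the open Euclidean ball of radius $r$ in $\mathbb{R}^2$ centered at the origin. The gradient descent-ascent (GDA) flow of $f$ started from $z(0)$ is the solution $(z(t))_{t \ge 0}$ of the ordinary differential equation $$\partial_t z(t) = \begin{pmatrix} -\partial_x f \\ \partial_y f \end{pmatrix}(z(t)).$$ Derivatives at boundary points of the square are understood as one-sided. *)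

theory Defs
  imports "HOL-Analysis.Analysis"
begin

definition unit_square :: "(real \<times> real) set" where
  "unit_square = {-1..1} \<times> {-1..1}"

text \<open>
  Functions on the square are modelled by functions on the whole plane whose values outside the
  square play no role: all derivatives below are taken within the interval from -1 to 1, hence are
  one-sided at its endpoints.
\<close>

definition partial_x :: "(real \<times> real \<Rightarrow> real) \<Rightarrow> real \<times> real \<Rightarrow> real" where
  "partial_x f = (\<lambda>(x, y). vector_derivative (\<lambda>s. f (s, y)) (at x within {-1..1}))"

definition partial_y :: "(real \<times> real \<Rightarrow> real) \<Rightarrow> real \<times> real \<Rightarrow> real" where
  "partial_y f = (\<lambda>(x, y). vector_derivative (\<lambda>s. f (x, s)) (at y within {-1..1}))"

definition C1_on_square :: "(real \<times> real \<Rightarrow> real) \<Rightarrow> bool" where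
  "C1_on_square f \<longleftrightarrow>
     (\<forall>x\<in>{-1..1}. \<forall>y\<in>{-1..1}.
        (\<lambda>s. f (s, y)) differentiable (at x within {-1..1}) \<and>
        (\<lambda>s. f (x, s)) differentiable (at y within {-1..1})) \<and>
     continuous_on unit_square (partial_x f) \<and>
     continuous_on unit_square (partial_y f)"

definition C2_on_square :: "(real \<times> real \<Rightarrow> real) \<Rightarrow> bool" where
  "C2_on_square f \<longleftrightarrow>
     C1_on_square f \<and> C1_on_square (partial_x f) \<and> C1_on_square (partial_y f)"

text \<open>
  A flow is a solution that is defined, and stays in the domain of \<open>f\<close>, for all nonnegative times;
  the values of \<open>z\<close> at negative times play no role.
\<close>

definition gda_flow ::
  "(real \<times> real \<Rightarrow> real) \<Rightarrow> real \<times> real \<Rightarrow> (real \<Rightarrow> real \<times> real) \<Rightarrow> bool" where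
  "gda_flow f z0 z \<longleftrightarrow>
     z 0 = z0 \<and>
     (\<forall>t\<ge>0. z t \<in> unit_square \<and>
        (z has_vector_derivative (- partial_x f (z t), partial_y f (z t))) (at t within {0..}))"

end

theory Submission
  imports Defs
begin

text \<open>
  The two inequalities make the origin a saddle point and exclude degenerate extrema on the axes.
  At the origin the right-hand sides vanish, so \<open>f (\<cdot>, 0)\<close> is minimal and \<open>f (0, \<cdot>)\<close> is maximal
  there. A Polyak--Lojasiewicz inequality forces a function of one variable to grow at least
  quadratically away from its minimisers; together with continuity of the second derivative this
  leaves only two possibilities, a constant function or a positive second derivative at the minimum
  (\<open>PL_critical_point_nondegenerate\<close>). Hence \<open>f\<^sub>x\<^sub>x > 0 > f\<^sub>y\<^sub>y\<close> at the origin and, by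
  continuity, \<open>f\<^sub>x\<^sub>x \<ge> m\<close> and \<open>f\<^sub>y\<^sub>y \<le> -m\<close> on a neighbourhood, for some \<open>m > 0\<close>.

  There \<open>f\<close> is strongly convex in \<open>x\<close> and strongly concave in \<open>y\<close>. Adding the tangent bounds for
  \<open>f (\<cdot>, y)\<close> and \<open>- f (x, \<cdot>)\<close>, the values \<open>f (x, y)\<close> cancel and
  \<open>x f\<^sub>x - y f\<^sub>y \<ge> f (x, 0) - f (0, y) + m/2 (x\<^sup>2 + y\<^sup>2) \<ge> m/2 (x\<^sup>2 + y\<^sup>2)\<close>,
  where the last step is the saddle property \<open>f (0, y) \<le> f (0, 0) \<le> f (x, 0)\<close>. So the field
  \<open>F = (- f\<^sub>x, f\<^sub>y)\<close> satisfies \<open>z \<bullet> F z \<le> - m/2 |z|\<^sup>2\<close>, and \<open>|z|\<^sup>2\<close> decays exponentially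
  along the flow.

  What remains is that the flow exists for all times and is unique. Composing \<open>F\<close> with the
  projection onto a small disc gives a field that is Lipschitz on the whole plane, whose flow is
  obtained from Banach's fixed point theorem; dissipativity keeps this flow in the disc, where the
  two fields agree (\<open>dissipative_flow_converges\<close>). Uniqueness is a Gronwall argument on the full
  square (\<open>lipschitz_flow_unique\<close>), since a competing flow is only known to stay in the square.
\<close>

section \<open>Differential inequalities\<close>

text \<open>
  The function \<open>\<phi> t * exp (- c * t)\<close> is nonincreasing. The sign of \<open>c\<close> is free: negative \<open>c\<close> yields
  decay, \<open>c = 0\<close> invariance of sublevel sets, and positive \<open>c\<close> uniqueness.
\<close>

lemma gronwall_exponential:
  fixes \<phi> \<phi>' :: "real \<Rightarrow> real"
  assumes deriv: "\<And>t. t \<ge> 0 \<Longrightarrow> (\<phi> has_real_derivative \<phi>' t) (at t within {0..})"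
    and le: "\<And>t. t \<ge> 0 \<Longrightarrow> \<phi>' t \<le> c * \<phi> t"
    and "t \<ge> 0"
  shows "\<phi> t \<le> \<phi> 0 * exp (c * t)"
proof -
  define \<psi> where "\<psi> = (\<lambda>t. \<phi> t * exp (- c * t))"
  have d: "(\<psi> has_real_derivative (\<phi>' s - c * \<phi> s) * exp (- c * s)) (at s within {0..})"
    if "s \<ge> 0" for s
    unfolding \<psi>_def
    by (rule derivative_eq_intros deriv that refl | simp add: algebra_simps)+
  have "\<psi> t \<le> \<psi> 0"
  proof (rule DERIV_nonpos_imp_decreasing_open[OF \<open>t \<ge> 0\<close>])
    fix s assume "0 < s" "s < t"
    then have "at s within {0..} = at s"
      by (intro at_within_interior) simp
    with d[of s] \<open>0 < s\<close>
    have "DERIV \<psi> s :> (\<phi>' s - c * \<phi> s) * exp (- c * s)" by simp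
    moreover have "(\<phi>' s - c * \<phi> s) * exp (- c * s) \<le> 0"
      using le[of s] \<open>0 < s\<close> by (intro mult_nonpos_nonneg) auto
    ultimately show "\<exists>y. DERIV \<psi> s :> y \<and> y \<le> 0" by blast
  next
    have "continuous_on {0..} \<psi>"
      by (rule DERIV_continuous_on, rule d) simp
    then show "continuous_on {0..t} \<psi>"
      by (rule continuous_on_subset) auto
  qed
  then have "\<phi> t * exp (- c * t) \<le> \<phi> 0" by (simp add: \<psi>_def)
  then show ?thesis by (simp add: exp_minus field_simps)
qed

lemma has_real_derivative_norm_squared:
  fixes z :: "real \<Rightarrow> 'a::real_inner"
  assumes "(z has_vector_derivative v) (at t within S)"
  shows "((\<lambda>t. (norm (z t))\<^sup>2) has_real_derivative 2 * (z t \<bullet> v)) (at t within S)"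
proof -
  have "((\<lambda>t. z t \<bullet> z t) has_derivative (\<lambda>h. z t \<bullet> (h *\<^sub>R v) + (h *\<^sub>R v) \<bullet> z t)) (at t within S)"
    using assms unfolding has_vector_derivative_def by (intro has_derivative_inner)
  moreover have "(\<lambda>h. z t \<bullet> (h *\<^sub>R v) + (h *\<^sub>R v) \<bullet> z t) = (*) (2 * (z t \<bullet> v))"
    by (auto simp: fun_eq_iff inner_commute algebra_simps)
  ultimately show ?thesis
    by (simp add: has_field_derivative_def power2_norm_eq_inner)
qed

text \<open>
  By Cauchy--Schwarz the squared distance of two solutions grows at most at the rate \<open>2 * L\<close>, so it
  stays zero.
\<close>

lemma lipschitz_flow_unique:
  fixes F :: "'a::real_inner \<Rightarrow> 'a"
  assumes lip: "L-lipschitz_on S F"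
    and z: "\<And>t. t \<ge> 0 \<Longrightarrow> z t \<in> S \<and> (z has_vector_derivative F (z t)) (at t within {0..})"
    and w: "\<And>t. t \<ge> 0 \<Longrightarrow> w t \<in> S \<and> (w has_vector_derivative F (w t)) (at t within {0..})"
    and "w 0 = z 0" "t \<ge> 0"
  shows "w t = z t"
proof -
  have "(norm (w t - z t))\<^sup>2 \<le> (norm (w 0 - z 0))\<^sup>2 * exp (2 * L * t)"
  proof (rule gronwall_exponential[OF _ _ \<open>t \<ge> 0\<close>])
    fix s :: real assume s: "s \<ge> 0"
    show "((\<lambda>s. (norm (w s - z s))\<^sup>2) has_real_derivative
        2 * ((w s - z s) \<bullet> (F (w s) - F (z s)))) (at s within {0..})"
      using z[OF s] w[OF s] by (intro has_real_derivative_norm_squared has_vector_derivative_diff) auto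
    have "(w s - z s) \<bullet> (F (w s) - F (z s)) \<le> norm (w s - z s) * norm (F (w s) - F (z s))"
      by (rule norm_cauchy_schwarz)
    also have "\<dots> \<le> norm (w s - z s) * (L * norm (w s - z s))"
      using lipschitz_onD[OF lip, of "w s" "z s"] z[OF s] w[OF s]
      by (intro mult_left_mono) (auto simp: dist_norm)
    finally show "2 * ((w s - z s) \<bullet> (F (w s) - F (z s))) \<le> 2 * L * (norm (w s - z s))\<^sup>2"
      by (simp add: power2_eq_square algebra_simps)
  qed
  with \<open>w 0 = z 0\<close> show ?thesis by simp
qed

section \<open>Global flows of Lipschitz vector fields\<close>

text \<open>
  Weighting by \<open>exp (- \<kappa> * \<tau>)\<close> makes integration gain a factor \<open>1 / \<kappa>\<close> uniformly in time. This
  estimate gives both the boundedness of the Picard operator and its contraction property.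
\<close>

lemma norm_integral_le_exponential:
  fixes g :: "real \<Rightarrow> 'a::banach"
  assumes "continuous_on UNIV g" "\<kappa> > 0" "\<tau> \<ge> 0"
    and le: "\<And>s. s \<ge> 0 \<Longrightarrow> norm (g s) \<le> K * exp (\<kappa> * s)"
  shows "norm (exp (- \<kappa> * \<tau>) *\<^sub>R integral {0..\<tau>} g) \<le> K / \<kappa>"
proof -
  have "K \<ge> 0" using order_trans[OF norm_ge_zero le[of 0]] by simp
  have I: "((\<lambda>s. K * exp (\<kappa> * s)) has_integral (K / \<kappa> * exp (\<kappa> * \<tau>) - K / \<kappa> * exp (\<kappa> * 0))) {0..\<tau>}"
    using \<open>\<tau> \<ge> 0\<close>
  proof (rule fundamental_theorem_of_calculus)
    show "((\<lambda>s. K / \<kappa> * exp (\<kappa> * s)) has_vector_derivative K * exp (\<kappa> * s)) (at s within {0..\<tau>})" for s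
      unfolding has_real_derivative_iff_has_vector_derivative[symmetric]
      using \<open>\<kappa> > 0\<close> by (auto intro!: derivative_eq_intros)
  qed
  have "norm (integral {0..\<tau>} g) \<le> integral {0..\<tau>} (\<lambda>s. K * exp (\<kappa> * s))"
  proof (rule integral_norm_bound_integral)
    show "g integrable_on {0..\<tau>}"
      by (intro integrable_continuous_real continuous_on_subset[OF assms(1)]) simp
    show "(\<lambda>s. K * exp (\<kappa> * s)) integrable_on {0..\<tau>}"
      using I by (rule has_integral_integrable)
  qed (use le in simp)
  also have "\<dots> \<le> K / \<kappa> * exp (\<kappa> * \<tau>)"
    using integral_unique[OF I] \<open>K \<ge> 0\<close> \<open>\<kappa> > 0\<close> by simp
  finally have "exp (- \<kappa> * \<tau>) * norm (integral {0..\<tau>} g) \<le> exp (- \<kappa> * \<tau>) * (K / \<kappa> * exp (\<kappa> * \<tau>))"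
    by (rule mult_left_mono) simp
  then show ?thesis by (simp add: exp_minus field_simps)
qed

lemma integral_has_vector_derivative_atLeast:
  fixes g :: "real \<Rightarrow> 'a::banach"
  assumes "continuous_on UNIV g" "t \<ge> 0"
  shows "((\<lambda>t. integral {0..t} g) has_vector_derivative g t) (at t within {0..})"
proof -
  have "((\<lambda>t. integral {0..t} g) has_vector_derivative g t) (at t within {0..t+1})"
    using assms(2) by (intro integral_has_vector_derivative continuous_on_subset[OF assms(1)]) auto
  moreover have "at t within {0..t+1} = at t within {0..}"
    by (rule at_within_nhd[where S = "{..<t+1}"]) auto
  ultimately show ?thesis by simp
qed

text \<open>
  The Picard operator is applied to \<open>u t = exp (- \<kappa> * t) *\<^sub>R (z t - z0)\<close> instead of \<open>z\<close>: in this
  weighted norm a large \<open>\<kappa>\<close> makes it a contraction on all nonnegative times at once, so that no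
  local solutions have to be glued together.
\<close>

lemma lipschitz_flow_exists:
  fixes G :: "'a::banach \<Rightarrow> 'a"
  assumes lip: "L-lipschitz_on UNIV G"
  shows "\<exists>z. z 0 = z0 \<and> (\<forall>t\<ge>0. (z has_vector_derivative G (z t)) (at t within {0..}))"
proof -
  have "L \<ge> 0" using lip by (rule lipschitz_on_nonneg)
  have contG: "continuous_on UNIV G"
    using lip by (rule lipschitz_on_continuous_on)
  \<comment> \<open>Any value above \<open>L\<close> would do; this one is positive even for \<open>L = 0\<close> and gives the factor \<open>1 / 2\<close>.\<close>
  define \<kappa> where "\<kappa> = 2 * L + 1"
  have "\<kappa> > 0" using \<open>L \<ge> 0\<close> by (simp add: \<kappa>_def)
  define g where "g = (\<lambda>u s. G (z0 + exp (\<kappa> * s) *\<^sub>R apply_bcontfun u s))"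
  \<comment> \<open>Bounded continuous functions live on the whole line, so negative times are frozen at \<open>0\<close>.\<close>
  define \<Phi> where "\<Phi> = (\<lambda>u t. exp (- \<kappa> * max 0 t) *\<^sub>R integral {0..max 0 t} (g u))"
  have contg: "continuous_on UNIV (g u)" for u :: "real \<Rightarrow>\<^sub>C 'a"
    unfolding g_def
    by (rule continuous_on_compose2[OF contG]) (auto intro!: continuous_intros)
  have \<Phi>_bcontfun: "\<Phi> u \<in> bcontfun" for u :: "real \<Rightarrow>\<^sub>C 'a"
  proof (rule bcontfun_normI)
    have "continuous_on {0..} (\<lambda>t. integral {0..t} (g u))"
      by (rule continuous_on_vector_derivative)
        (auto intro: integral_has_vector_derivative_atLeast contg)
    then have "continuous_on UNIV (\<lambda>t. integral {0..max 0 t} (g u))"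
      by (rule continuous_on_compose2) (auto intro!: continuous_intros)
    then show "continuous_on UNIV (\<Phi> u)"
      unfolding \<Phi>_def by (intro continuous_intros)
    have "norm (g u s) \<le> (norm (G z0) + L * norm u) * exp (\<kappa> * s)" if "s \<ge> 0" for s
    proof -
      have "norm (g u s) \<le> norm (G z0) + norm (g u s - G z0)"
        by (rule norm_triangle_sub)
      also have "norm (g u s - G z0) \<le> L * norm (exp (\<kappa> * s) *\<^sub>R apply_bcontfun u s)"
        using lipschitz_onD[OF lip, of "z0 + exp (\<kappa> * s) *\<^sub>R apply_bcontfun u s" z0]
        by (simp add: g_def dist_norm)
      also have "\<dots> \<le> L * (exp (\<kappa> * s) * norm u)"
        using \<open>L \<ge> 0\<close> norm_bounded[of u s] by (auto intro!: mult_left_mono)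
      also have "norm (G z0) \<le> norm (G z0) * exp (\<kappa> * s)"
        using that \<open>\<kappa> > 0\<close> by (simp add: mult_le_cancel_left1)
      finally show ?thesis by (simp add: algebra_simps)
    qed
    then show "norm (\<Phi> u t) \<le> (norm (G z0) + L * norm u) / \<kappa>" for t
      unfolding \<Phi>_def using \<open>\<kappa> > 0\<close>
      by (intro norm_integral_le_exponential contg) auto
  qed
  have \<Phi>_contracts: "dist (\<Phi> u t) (\<Phi> v t) \<le> 1 / 2 * dist u v" for u v :: "real \<Rightarrow>\<^sub>C 'a" and t
  proof -
    let ?\<tau> = "max 0 t"
    have "g u integrable_on {0..?\<tau>}" "g v integrable_on {0..?\<tau>}"
      by (intro integrable_continuous_real continuous_on_subset[OF contg] subset_UNIV)+
    then have "\<Phi> u t - \<Phi> v t = exp (- \<kappa> * ?\<tau>) *\<^sub>R integral {0..?\<tau>} (\<lambda>s. g u s - g v s)"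
      by (simp add: \<Phi>_def integral_diff scaleR_diff_right)
    also have "norm \<dots> \<le> L * dist u v / \<kappa>"
    proof (rule norm_integral_le_exponential)
      show "continuous_on UNIV (\<lambda>s. g u s - g v s)"
        by (intro continuous_intros contg)
      fix s :: real
      have "norm (g u s - g v s) \<le> L * dist (exp (\<kappa> * s) *\<^sub>R apply_bcontfun u s) (exp (\<kappa> * s) *\<^sub>R apply_bcontfun v s)"
        using lipschitz_onD[OF lip, of "z0 + exp (\<kappa> * s) *\<^sub>R apply_bcontfun u s"
            "z0 + exp (\<kappa> * s) *\<^sub>R apply_bcontfun v s"]
        by (simp add: g_def dist_norm)
      also have "\<dots> = L * (exp (\<kappa> * s) * dist (apply_bcontfun u s) (apply_bcontfun v s))"
        by (simp add: dist_norm flip: scaleR_diff_right)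
      also have "\<dots> \<le> L * (exp (\<kappa> * s) * dist u v)"
        using \<open>L \<ge> 0\<close> dist_bounded[of u s v] by (auto intro!: mult_left_mono)
      finally show "norm (g u s - g v s) \<le> L * dist u v * exp (\<kappa> * s)"
        by (simp add: algebra_simps)
    qed (use \<open>\<kappa> > 0\<close> in auto)
    also have "\<dots> \<le> 1 / 2 * dist u v"
    proof -
      have "L / \<kappa> \<le> 1 / 2" using \<open>L \<ge> 0\<close> by (simp add: \<kappa>_def field_simps)
      from mult_right_mono[OF this zero_le_dist[of u v]] show ?thesis by simp
    qed
    finally show ?thesis by (simp add: dist_norm)
  qed
  have "\<exists>!u. Bcontfun (\<Phi> u) = u"
  proof (rule banach_fix_type[of "1 / 2"])
    show "\<forall>u v. dist (Bcontfun (\<Phi> u)) (Bcontfun (\<Phi> v)) \<le> 1 / 2 * dist u v"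
      by (intro allI dist_bound) (simp only: Bcontfun_inverse \<Phi>_bcontfun \<Phi>_contracts)
  qed auto
  then obtain u where "Bcontfun (\<Phi> u) = u" by blast
  then have u: "apply_bcontfun u = \<Phi> u"
    by (metis Bcontfun_inverse \<Phi>_bcontfun)
  define z where "z = (\<lambda>t. z0 + integral {0..t} (g u))"
  have "g u t = G (z t)" if "t \<ge> 0" for t
    using that by (simp add: g_def[THEN fun_cong, THEN fun_cong] u z_def \<Phi>_def exp_minus)
  then have "(z has_vector_derivative G (z t)) (at t within {0..})" if "t \<ge> 0" for t
    unfolding z_def
    using integral_has_vector_derivative_atLeast[OF contg that, of u] that
    by (auto simp: z_def intro!: derivative_eq_intros)
  moreover have "z 0 = z0" by (simp add: z_def)
  ultimately show ?thesis by blast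
qed

section \<open>Flows of dissipative vector fields\<close>

lemma closest_point_cball_outside:
  fixes z :: "'a::euclidean_space"
  assumes "R > 0" "norm z \<ge> R"
  shows "closest_point (cball 0 R) z = (R / norm z) *\<^sub>R z"
proof (rule closest_point_unique[symmetric])
  have "norm z > 0" using assms by linarith
  then show "(R / norm z) *\<^sub>R z \<in> cball 0 R" using assms by simp
  have "z - (R / norm z) *\<^sub>R z = (1 - R / norm z) *\<^sub>R z"
    by (simp add: scaleR_diff_left)
  then have "dist z ((R / norm z) *\<^sub>R z) = \<bar>1 - R / norm z\<bar> * norm z"
    by (simp add: dist_norm)
  also have "\<dots> = norm z - R"
    using assms \<open>norm z > 0\<close> by (simp add: abs_of_nonneg field_simps)
  finally have dist: "dist z ((R / norm z) *\<^sub>R z) = norm z - R" .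
  show "\<forall>q\<in>cball 0 R. dist z ((R / norm z) *\<^sub>R z) \<le> dist z q"
  proof
    fix q :: 'a assume "q \<in> cball 0 R"
    then show "dist z ((R / norm z) *\<^sub>R z) \<le> dist z q"
      unfolding dist using norm_triangle_ineq2[of z q] by (simp add: dist_norm)
  qed
qed auto

text \<open>
  The field is extended from the ball to the whole space by composing it with the metric projection
  \<open>P\<close>, which is 1-Lipschitz. Outside the ball \<open>P q\<close> is a positive multiple of \<open>q\<close>, so the extended
  field points outward nowhere. Hence the norm cannot increase along the extended flow,
  which therefore never leaves the ball and is a flow of the original field.
\<close>

lemma dissipative_flow_converges:
  fixes F :: "'a::euclidean_space \<Rightarrow> 'a"
  assumes "R > 0" "\<mu> > 0"
    and lip: "L-lipschitz_on (cball 0 R) F"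
    and diss: "\<And>z. z \<in> cball 0 R \<Longrightarrow> z \<bullet> F z \<le> - \<mu> * (norm z)\<^sup>2"
    and z0: "z0 \<in> cball 0 R"
  shows "\<exists>z. z 0 = z0 \<and>
    (\<forall>t\<ge>0. z t \<in> cball 0 R \<and> (z has_vector_derivative F (z t)) (at t within {0..})) \<and>
    (z \<longlongrightarrow> 0) at_top"
proof -
  define P where "P = closest_point (cball 0 R :: 'a set)"
  have P_in: "P z \<in> cball 0 R" for z
    unfolding P_def using \<open>R > 0\<close> by (intro closest_point_in_set) auto
  have "1-lipschitz_on UNIV P"
    unfolding P_def using \<open>R > 0\<close> by (intro lipschitz_onI) (auto intro: closest_point_lipschitz)
  then have "(L * 1)-lipschitz_on UNIV (\<lambda>z. F (P z))"
    using P_in by (intro lipschitz_on_compose2 lipschitz_on_subset[OF lip]) auto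
  then have "L-lipschitz_on UNIV (\<lambda>z. F (P z))" by simp
  from lipschitz_flow_exists[OF this, of z0] obtain z where
    z: "z 0 = z0" "\<And>t. t \<ge> 0 \<Longrightarrow> (z has_vector_derivative F (P (z t))) (at t within {0..})"
    by blast
  have inward: "q \<bullet> F (P q) \<le> 0" for q
  proof (cases "norm q \<ge> R")
    case True
    then have "q = (norm q / R) *\<^sub>R P q"
      using \<open>R > 0\<close> by (auto simp: P_def closest_point_cball_outside)
    then have "q \<bullet> F (P q) = norm q / R * (P q \<bullet> F (P q))"
      by (metis inner_scaleR_left)
    also have "\<dots> \<le> 0"
      using diss[OF P_in[of q]] \<open>\<mu> > 0\<close> \<open>R > 0\<close>
      by (intro mult_nonneg_nonpos) (auto intro: order_trans)
    finally show ?thesis .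
  next
    case False
    then have "q \<in> cball 0 R" by simp
    then show ?thesis
      using diss[of q] \<open>\<mu> > 0\<close> by (auto simp: P_def closest_point_self intro: order_trans)
  qed
  have stays: "z t \<in> cball 0 R" if "t \<ge> 0" for t
  proof -
    have "(norm (z t))\<^sup>2 \<le> (norm (z 0))\<^sup>2 * exp (0 * t)"
      using that inward
      by (intro gronwall_exponential[OF has_real_derivative_norm_squared[OF z(2)]]) auto
    then have "norm (z t) \<le> norm z0" using z(1) by (simp add: power2_le_iff_abs_le)
    with z0 show ?thesis by simp
  qed
  have deriv: "(z has_vector_derivative F (z t)) (at t within {0..})" if "t \<ge> 0" for t
    using z(2)[OF that] stays[OF that] by (simp add: P_def closest_point_self)
  have decay: "(norm (z t))\<^sup>2 \<le> (norm z0)\<^sup>2 * exp (- 2 * \<mu> * t)" if "t \<ge> 0" for t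
    unfolding z(1)[symmetric] using that
  proof (intro gronwall_exponential[OF has_real_derivative_norm_squared[OF deriv]])
    show "2 * (z s \<bullet> F (z s)) \<le> - 2 * \<mu> * (norm (z s))\<^sup>2" if "s \<ge> 0" for s
      using diss[OF stays[OF that]] by simp
  qed auto
  have "((\<lambda>t. (norm (z t))\<^sup>2) \<longlongrightarrow> 0) at_top"
  proof (rule tendsto_sandwich[OF _ _ tendsto_const])
    have "LIM t at_top. - 2 * \<mu> * t :> at_bot"
      using \<open>\<mu> > 0\<close> by (intro filterlim_tendsto_neg_mult_at_bot[OF tendsto_const] filterlim_ident) auto
    then have "((\<lambda>t. exp (- 2 * \<mu> * t)) \<longlongrightarrow> 0) at_top"
      by (rule filterlim_compose[OF exp_at_bot])
    then show "((\<lambda>t. (norm z0)\<^sup>2 * exp (- 2 * \<mu> * t)) \<longlongrightarrow> 0) at_top"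
      by (rule tendsto_mult_right_zero)
    show "\<forall>\<^sub>F t in at_top. (norm (z t))\<^sup>2 \<le> (norm z0)\<^sup>2 * exp (- 2 * \<mu> * t)"
      using eventually_ge_at_top[of 0] by eventually_elim (rule decay)
  qed auto
  then have "((\<lambda>t. sqrt ((norm (z t))\<^sup>2)) \<longlongrightarrow> sqrt 0) at_top"
    by (rule tendsto_real_sqrt)
  then have "(z \<longlongrightarrow> 0) at_top"
    by (simp add: tendsto_norm_zero_iff)
  with z(1) stays deriv show ?thesis by blast
qed

section \<open>The Polyak--Lojasiewicz inequality in one variable\<close>

text \<open>
  If \<open>g\<close> exceeds its minimum somewhere, let \<open>x0\<close> be the last minimiser before that point. No critical
  point lies above the minimum, so \<open>g\<close> cannot rise and come back between two minimisers: \<open>g\<close> is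
  constant on \<open>[0, x0]\<close>, and \<open>g'' x0 \<le> 0\<close>. Just to the right of \<open>x0\<close> the function increases while
  \<open>g'' < 1 / (4 * C)\<close>. Integrating \<open>g' * g''\<close> gives \<open>(g')\<^sup>2 \<le> (g - g 0) / (2 * C)\<close>, and the
  Polyak--Lojasiewicz inequality bounds the right-hand side by \<open>(g')\<^sup>2 / 2\<close>, so \<open>g' = 0\<close> there,
  which is absurd.
\<close>

lemma PL_degenerate_min_imp_constant_right:
  fixes g g' g'' :: "real \<Rightarrow> real"
  assumes d1: "\<And>x. x \<in> {0..1} \<Longrightarrow> (g has_real_derivative g' x) (at x within {0..1})"
    and d2: "\<And>x. x \<in> {0..1} \<Longrightarrow> (g' has_real_derivative g'' x) (at x within {0..1})"
    and c2: "continuous_on {0..1} g''"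
    and crit: "g' 0 = 0" and degenerate: "g'' 0 \<le> 0"
    and min: "\<And>x. x \<in> {0..1} \<Longrightarrow> g 0 \<le> g x"
    and PL: "\<And>x. x \<in> {0..1} \<Longrightarrow> g x - g 0 \<le> C * (g' x)\<^sup>2"
    and x1: "x1 \<in> {0..1}"
  shows "g x1 = g 0"
proof (rule ccontr)
  assume "g x1 \<noteq> g 0"
  with min[OF x1] have "g x1 > g 0" by simp
  have D1: "DERIV g x :> g' x" and D2: "DERIV g' x :> g'' x" if "0 < x" "x < 1" for x
    using d1[of x] d2[of x] that by (simp_all add: at_within_Icc_at)
  have c0: "continuous_on {0..1} g" and c1: "continuous_on {0..1} g'"
    by (rule DERIV_continuous_on, erule d1) (rule DERIV_continuous_on, erule d2)
  have "C > 0"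
  proof (rule ccontr)
    assume "\<not> C > 0"
    then have "C * (g' x1)\<^sup>2 \<le> 0" by (simp add: mult_nonpos_nonneg)
    with PL[OF x1] \<open>g x1 > g 0\<close> show False by simp
  qed
  have crit_if_min: "g' x = 0" if "g x = g 0" "0 \<le> x" "x < 1" for x
  proof (cases "x = 0")
    case False
    with that have "0 < x" by simp
    show ?thesis
    proof (rule DERIV_local_min[OF D1])
      show "0 < x" "x < 1" "0 < min x (1 - x)" using \<open>0 < x\<close> that by auto
      show "\<forall>y. \<bar>x - y\<bar> < min x (1 - x) \<longrightarrow> g x \<le> g y"
        using that(1) min by (auto simp: abs_less_iff)
    qed
  qed (use crit in auto)
  define Z where "Z = {x \<in> {0..x1}. g x = g 0}"
  have "compact Z"
  proof -
    have "continuous_on {0..x1} g" using x1 by (intro continuous_on_subset[OF c0]) auto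
    then have "closed Z" unfolding Z_def
      by (intro continuous_closed_preimage_constant) auto
    moreover have "Z = {0..x1} \<inter> Z" by (auto simp: Z_def)
    ultimately show ?thesis by (metis compact_Icc compact_Int_closed)
  qed
  moreover have "0 \<in> Z" using x1 by (simp add: Z_def)
  ultimately obtain x0 where x0: "x0 \<in> Z" and last: "\<And>x. x \<in> Z \<Longrightarrow> x \<le> x0"
    using compact_attains_sup[of Z] by blast
  have "0 \<le> x0" "x0 < x1" "g x0 = g 0"
    using x0 \<open>g x1 > g 0\<close> by (auto simp: Z_def less_le)
  then have "x0 < 1" using x1 by simp
  have above: "g x > g 0" if "x0 < x" "x \<le> x1" for x
  proof -
    have "x \<in> {0..1}" using that \<open>0 \<le> x0\<close> x1 by auto
    moreover have "x \<notin> Z" using last[of x] that by auto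
    ultimately show ?thesis
      using min[of x] that x1 by (auto simp: Z_def less_le)
  qed
  have noncrit: "g' x \<noteq> 0" if "x0 < x" "x \<le> x1" for x
    using above[OF that] PL[of x] that \<open>0 \<le> x0\<close> x1 by auto
  have "g' x0 = 0"
    by (rule crit_if_min) fact+
  have "g'' x0 \<le> 0"
  proof (cases "x0 = 0")
    case False
    with \<open>0 \<le> x0\<close> have "0 < x0" by simp
    \<comment> \<open>A maximiser of \<open>g\<close> on \<open>[0, x0]\<close> is critical or an endpoint, hence a minimiser.\<close>
    have flat: "g' x = 0" if "0 < x" "x < x0" for x
    proof -
      obtain \<xi> where \<xi>: "\<xi> \<in> {0..x0}" "\<And>y. y \<in> {0..x0} \<Longrightarrow> g y \<le> g \<xi>"
        using continuous_attains_sup[of "{0..x0}" g] continuous_on_subset[OF c0, of "{0..x0}"]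
          \<open>0 < x0\<close> \<open>x0 < 1\<close> by auto
      have "g \<xi> = g 0"
      proof (cases "\<xi> = 0 \<or> \<xi> = x0")
        case False
        with \<xi> have "0 < \<xi>" "\<xi> < x0" by auto
        have "g' \<xi> = 0"
        proof (rule DERIV_local_max[OF D1])
          show "0 < \<xi>" "\<xi> < 1" "0 < min \<xi> (x0 - \<xi>)"
            using \<open>0 < \<xi>\<close> \<open>\<xi> < x0\<close> \<open>x0 < 1\<close> by auto
          show "\<forall>y. \<bar>\<xi> - y\<bar> < min \<xi> (x0 - \<xi>) \<longrightarrow> g y \<le> g \<xi>"
            using \<xi>(2) by (auto simp: abs_less_iff)
        qed
        moreover have "\<xi> \<in> {0..1}" using \<xi>(1) \<open>x0 < 1\<close> by simp
        ultimately show ?thesis using PL[of \<xi>] min[of \<xi>] by simp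
      qed (use \<open>g x0 = g 0\<close> in auto)
      then have "g x = g 0"
        using \<xi>(2)[of x] min[of x] that \<open>x0 < 1\<close> by auto
      then show ?thesis using crit_if_min that \<open>x0 < 1\<close> by auto
    qed
    show ?thesis
    proof (rule ccontr)
      \<comment> \<open>Otherwise \<open>g'\<close> would be negative just to the left of \<open>x0\<close>.\<close>
      assume "\<not> g'' x0 \<le> 0"
      then obtain d where d: "d > 0" "\<And>h. h > 0 \<Longrightarrow> h < d \<Longrightarrow> g' (x0 - h) < g' x0"
        using DERIV_pos_inc_left[OF D2[OF \<open>0 < x0\<close> \<open>x0 < 1\<close>]] by auto
      define h where "h = min d x0 / 2"
      have "0 < h" "h < d" "h < x0" using d \<open>0 < x0\<close> by (auto simp: h_def)
      then show False using d(2)[of h] flat[of "x0 - h"] \<open>g' x0 = 0\<close> by auto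
    qed
  qed (use degenerate in simp)
  obtain \<eta> where "\<eta> > 0" and \<eta>: "\<And>x. x \<in> {0..1} \<Longrightarrow> \<bar>x - x0\<bar> < \<eta> \<Longrightarrow> g'' x < 1 / (4 * C)"
  proof -
    have "x0 \<in> {0..1}" "1 / (4 * C) > 0" using \<open>C > 0\<close> \<open>0 \<le> x0\<close> \<open>x0 < 1\<close> by auto
    with c2 obtain \<eta> where \<eta>: "\<eta> > 0"
      "\<forall>x\<in>{0..1}. dist x x0 < \<eta> \<longrightarrow> dist (g'' x) (g'' x0) < 1 / (4 * C)"
      unfolding continuous_on_iff by blast
    show ?thesis
    proof (rule that[OF \<eta>(1)])
      fix x :: real assume "x \<in> {0..1}" "\<bar>x - x0\<bar> < \<eta>"
      with \<eta>(2) have "\<bar>g'' x - g'' x0\<bar> < 1 / (4 * C)" by (simp add: dist_real_def)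
      with \<open>g'' x0 \<le> 0\<close> show "g'' x < 1 / (4 * C)" by linarith
    qed
  qed
  \<comment> \<open>Between \<open>x0\<close> and \<open>x2\<close> the bound on \<open>g''\<close> and the absence of critical points both hold.\<close>
  define x2 where "x2 = min x1 (x0 + \<eta> / 2)"
  have x2: "x0 < x2" "x2 \<le> x1" "x2 < x0 + \<eta>"
    using \<open>\<eta> > 0\<close> \<open>x0 < x1\<close> by (auto simp: x2_def min_def)
  obtain \<xi> where \<xi>: "x0 < \<xi>" "\<xi> < x2" "g' \<xi> > 0"
  proof -
    have "continuous_on {x0..x2} g"
      using x2 x1 \<open>0 \<le> x0\<close> by (intro continuous_on_subset[OF c0]) auto
    moreover have "(g has_derivative (*) (g' x)) (at x)" if "x0 < x" "x < x2" for x
      using D1[of x] that x2 x1 \<open>0 \<le> x0\<close> by (simp add: has_field_derivative_def)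
    ultimately obtain \<xi> where \<xi>: "x0 < \<xi>" "\<xi> < x2" "g x2 - g x0 = g' \<xi> * (x2 - x0)"
      using mvt[OF \<open>x0 < x2\<close>, of g "\<lambda>x. (*) (g' x)"] by metis
    have "g' \<xi> * (x2 - x0) > 0"
      using above[of x2] x2 \<open>g x0 = g 0\<close> \<xi>(3) by simp
    then have "g' \<xi> > 0" using x2 by (simp add: zero_less_mult_iff)
    with \<xi> show ?thesis by (intro that[of \<xi>]) auto
  qed
  have incr: "g' x > 0" if x: "x0 < x" "x \<le> \<xi>" for x
  proof (rule ccontr)
    assume "\<not> g' x > 0"
    moreover have "continuous_on {x..\<xi>} g'"
      using x \<xi> x2 x1 \<open>0 \<le> x0\<close> by (intro continuous_on_subset[OF c1]) auto
    ultimately obtain y where "x \<le> y" "y \<le> \<xi>" "g' y = 0"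
      using IVT'[of g' x 0 \<xi>] x \<xi> by auto
    with noncrit[of y] x \<xi> x2 show False by auto
  qed
  define W where "W = (\<lambda>x. (g' x)\<^sup>2 - (g x - g 0) / (2 * C))"
  have "W \<xi> \<le> W x0"
  proof (rule DERIV_nonpos_imp_decreasing_open[of x0 \<xi> W])
    show "x0 \<le> \<xi>" using \<xi> by simp
    show "continuous_on {x0..\<xi>} W"
      unfolding W_def using \<open>C > 0\<close> \<xi> x2 x1 \<open>0 \<le> x0\<close>
      by (intro continuous_intros continuous_on_subset[OF c0] continuous_on_subset[OF c1]) auto
    fix x assume x: "x0 < x" "x < \<xi>"
    then have x': "0 < x" "x < 1" using \<xi> x2 x1 \<open>0 \<le> x0\<close> by auto
    have "DERIV W x :> 2 * g' x * (g'' x - 1 / (4 * C))"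
      unfolding W_def using \<open>C > 0\<close>
      by (auto intro!: derivative_eq_intros D1[OF x'] D2[OF x'] simp: field_simps)
    moreover have "2 * g' x * (g'' x - 1 / (4 * C)) \<le> 0"
      using incr[of x] \<eta>[of x] x x' \<xi> x2 by (intro mult_nonneg_nonpos) auto
    ultimately show "\<exists>y. DERIV W x :> y \<and> y \<le> 0" by blast
  qed
  then have "(g' \<xi>)\<^sup>2 \<le> (g \<xi> - g 0) / (2 * C)"
    using \<open>g' x0 = 0\<close> \<open>g x0 = g 0\<close> by (simp add: W_def)
  also have "\<dots> \<le> C * (g' \<xi>)\<^sup>2 / (2 * C)"
    using PL[of \<xi>] \<xi> x2 x1 \<open>0 \<le> x0\<close> \<open>C > 0\<close> by (intro divide_right_mono) auto
  also have "\<dots> = (g' \<xi>)\<^sup>2 / 2" using \<open>C > 0\<close> by simp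
  finally show False using \<xi> by simp
qed

lemma PL_critical_point_is_minimum:
  fixes g :: "real \<Rightarrow> real"
  assumes "continuous_on {-1..1} g" "g' 0 = 0"
    and PL: "\<And>x. x \<in> {-1..1} \<Longrightarrow> g x - (INF x'\<in>{-1..1}. g x') \<le> C * (g' x)\<^sup>2"
    and "x \<in> {-1..1}"
  shows "g 0 \<le> g x" and "g x - g 0 \<le> C * (g' x)\<^sup>2"
proof -
  have "compact (g ` {-1..1})"
    using assms(1) by (intro compact_continuous_image) auto
  then have bdd: "bdd_below (g ` {-1..1})"
    by (intro bounded_imp_bdd_below compact_imp_bounded)
  have "g 0 \<le> (INF x'\<in>{-1..1}. g x')" using PL[of 0] \<open>g' 0 = 0\<close> by simp
  also have "\<dots> \<le> g x" using bdd \<open>x \<in> {-1..1}\<close> by (rule cINF_lower)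
  finally show "g 0 \<le> g x" .
  have "(INF x'\<in>{-1..1}. g x') \<le> g 0" using bdd by (rule cINF_lower) simp
  with PL[OF \<open>x \<in> {-1..1}\<close>] show "g x - g 0 \<le> C * (g' x)\<^sup>2" by simp
qed

text \<open>
  The one-sided result is applied to \<open>g\<close> and to its reflection: a nonpositive second derivative at
  \<open>0\<close> would make \<open>g\<close> constant on both halves of the interval.
\<close>

lemma PL_critical_point_nondegenerate:
  fixes g g' g'' :: "real \<Rightarrow> real"
  assumes d1: "\<And>x. x \<in> {-1..1} \<Longrightarrow> (g has_real_derivative g' x) (at x within {-1..1})"
    and d2: "\<And>x. x \<in> {-1..1} \<Longrightarrow> (g' has_real_derivative g'' x) (at x within {-1..1})"
    and c2: "continuous_on {-1..1} g''"
    and crit: "g' 0 = 0"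
    and PL: "\<And>x. x \<in> {-1..1} \<Longrightarrow> g x - (INF x'\<in>{-1..1}. g x') \<le> C * (g' x)\<^sup>2"
    and nonconst: "\<not> g constant_on {-1..1}"
  shows "g'' 0 > 0"
proof (rule ccontr)
  assume "\<not> g'' 0 > 0"
  then have degenerate: "g'' 0 \<le> 0" by simp
  have c0: "continuous_on {-1..1} g" by (rule DERIV_continuous_on, erule d1)
  note min = PL_critical_point_is_minimum[of g g' C, OF c0 crit PL]
  have right: "g x = g 0" if "x \<in> {0..1}" for x
  proof (rule PL_degenerate_min_imp_constant_right[of g g' g'' C])
    show "(g has_real_derivative g' x) (at x within {0..1})"
      "(g' has_real_derivative g'' x) (at x within {0..1})" if "x \<in> {0..1}" for x
      using d1[of x] d2[of x] that by (auto elim: DERIV_subset)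
    show "continuous_on {0..1} g''" using c2 by (rule continuous_on_subset) auto
  qed (use crit degenerate min that in auto)
  have left: "g (- x) = g (- 0)" if "x \<in> {0..1}" for x
  proof (rule PL_degenerate_min_imp_constant_right
      [of "\<lambda>x. g (- x)" "\<lambda>x. - g' (- x)" "\<lambda>x. g'' (- x)" C])
    have reflect: "((\<lambda>x. h (- x)) has_real_derivative - h' (- x)) (at x within {0..1})"
      if "\<And>x. x \<in> {-1..1} \<Longrightarrow> (h has_real_derivative h' x) (at x within {-1..1})" "x \<in> {0..1}"
      for h h' :: "real \<Rightarrow> real" and x
    proof -
      have "(h has_real_derivative h' (- x)) (at (- x) within uminus ` {0..1})"
        using that(1)[of "- x"] that(2) by (auto elim: DERIV_subset)
      then have "(h \<circ> uminus has_real_derivative h' (- x) * (- 1)) (at x within {0..1})"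
        by (rule DERIV_image_chain) (auto intro!: derivative_eq_intros)
      then show ?thesis by (simp add: o_def)
    qed
    show "((\<lambda>x. g (- x)) has_real_derivative - g' (- x)) (at x within {0..1})"
      if "x \<in> {0..1}" for x
      using d1 that by (rule reflect)
    show "((\<lambda>x. - g' (- x)) has_real_derivative g'' (- x)) (at x within {0..1})"
      if "x \<in> {0..1}" for x
      using DERIV_minus[OF reflect[of g' g'', OF d2 that]] by simp
    show "continuous_on {0..1} (\<lambda>x. g'' (- x))"
      by (rule continuous_on_compose2[OF c2]) (auto intro!: continuous_intros)
  qed (use crit degenerate min that in auto)
  have "g x = g 0" if "x \<in> {-1..1}" for x
    using that right[of x] left[of "- x"] by (cases "x \<ge> 0") auto
  with nonconst show False unfolding constant_on_def by blast
qed

section \<open>Functions on the square\<close>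

lemma partial_x_has_derivative:
  assumes "C1_on_square g" "x \<in> {-1..1}" "y \<in> {-1..1}"
  shows "((\<lambda>s. g (s, y)) has_real_derivative partial_x g (x, y)) (at x within {-1..1})"
  using assms
  by (simp add: C1_on_square_def partial_x_def has_real_derivative_iff_has_vector_derivative
      vector_derivative_works)

lemma partial_y_has_derivative:
  assumes "C1_on_square g" "x \<in> {-1..1}" "y \<in> {-1..1}"
  shows "((\<lambda>s. g (x, s)) has_real_derivative partial_y g (x, y)) (at y within {-1..1})"
  using assms
  by (simp add: C1_on_square_def partial_y_def has_real_derivative_iff_has_vector_derivative
      vector_derivative_works)

lemma C1_on_square_imp_lipschitz:
  assumes C1: "C1_on_square g"
  shows "\<exists>L. L-lipschitz_on unit_square g"
proof -
  have "compact unit_square" unfolding unit_square_def by (intro compact_Times) auto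
  then have "bounded (partial_x g ` unit_square)" "bounded (partial_y g ` unit_square)"
    using C1 by (auto simp: C1_on_square_def intro!: compact_imp_bounded compact_continuous_image)
  then obtain A B where
    A: "\<And>p. p \<in> unit_square \<Longrightarrow> \<bar>partial_x g p\<bar> \<le> A" and
    B: "\<And>p. p \<in> unit_square \<Longrightarrow> \<bar>partial_y g p\<bar> \<le> B"
    by (auto simp: bounded_iff)
  have "A \<ge> 0" "B \<ge> 0"
    using A[of "(0, 0)"] B[of "(0, 0)"] by (auto simp: unit_square_def)
  have "(A + B)-lipschitz_on unit_square g"
  proof (rule lipschitz_onI)
    fix p q assume pq: "p \<in> unit_square" "q \<in> unit_square"
    obtain x y x' y' where [simp]: "p = (x, y)" "q = (x', y')" by fastforce
    have xy: "x \<in> {-1..1}" "y \<in> {-1..1}" "x' \<in> {-1..1}" "y' \<in> {-1..1}"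
      using pq by (auto simp: unit_square_def)
    have "norm (g (x, y) - g (x', y)) \<le> A * norm (x - x')"
    proof (rule field_differentiable_bound[of "{-1..1}" "\<lambda>s. g (s, y)" "\<lambda>s. partial_x g (s, y)"])
      show "((\<lambda>s. g (s, y)) has_field_derivative partial_x g (s, y)) (at s within {-1..1})"
        if "s \<in> {-1..1}" for s using partial_x_has_derivative[OF C1 that xy(2)] .
    qed (use A xy in \<open>auto simp: unit_square_def\<close>)
    moreover have "norm (g (x', y) - g (x', y')) \<le> B * norm (y - y')"
    proof (rule field_differentiable_bound[of "{-1..1}" "\<lambda>s. g (x', s)" "\<lambda>s. partial_y g (x', s)"])
      show "((\<lambda>s. g (x', s)) has_field_derivative partial_y g (x', s)) (at s within {-1..1})"
        if "s \<in> {-1..1}" for s using partial_y_has_derivative[OF C1 xy(3) that] .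
    qed (use B xy in \<open>auto simp: unit_square_def\<close>)
    moreover have "A * norm (x - x') \<le> A * dist p q" "B * norm (y - y') \<le> B * dist p q"
      using \<open>A \<ge> 0\<close> \<open>B \<ge> 0\<close> dist_fst_le[of p q] dist_snd_le[of p q]
      by (auto intro!: mult_left_mono simp: dist_real_def)
    ultimately show "dist (g p) (g q) \<le> (A + B) * dist p q"
      by (simp add: dist_real_def algebra_simps)
  qed (use \<open>A \<ge> 0\<close> \<open>B \<ge> 0\<close> in simp)
  then show ?thesis by blast
qed

section \<open>Strong convexity and the saddle point\<close>

text \<open>
  Subtracting \<open>m / 2 * s\<^sup>2\<close> leaves a convex function, which lies above its tangent at \<open>x\<close>; the
  bound is that tangent evaluated at \<open>0\<close>.
\<close>

lemma strong_convexity_tangent_bound: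
  fixes p p' p'' :: "real \<Rightarrow> real"
  assumes d1: "\<And>s. \<bar>s\<bar> < \<delta> \<Longrightarrow> DERIV p s :> p' s"
    and d2: "\<And>s. \<bar>s\<bar> < \<delta> \<Longrightarrow> DERIV p' s :> p'' s"
    and ge: "\<And>s. \<bar>s\<bar> < \<delta> \<Longrightarrow> p'' s \<ge> m"
    and "\<bar>x\<bar> < \<delta>"
  shows "p x - p 0 + m / 2 * x\<^sup>2 \<le> x * p' x"
proof -
  define q where "q = (\<lambda>s. p s - m / 2 * s\<^sup>2)"
  let ?A = "{-\<delta><..<\<delta>}"
  have dq: "DERIV q s :> p' s - m * s" if "s \<in> ?A" for s
    unfolding q_def using that by (auto intro!: derivative_eq_intros d1)
  have "convex_on ?A q"
  proof (rule f''_ge0_imp_convex[OF _ dq])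
    show "DERIV (\<lambda>s. p' s - m * s) s :> p'' s - m" if "s \<in> ?A" for s
      using that by (auto intro!: derivative_eq_intros d2)
    show "p'' s - m \<ge> 0" if "s \<in> ?A" for s using ge[of s] that by auto
  qed auto
  then have "q 0 - q x \<ge> (p' x - m * x) * (0 - x)"
  proof (rule convex_on_imp_above_tangent[of ?A q x 0 "p' x - m * x"])
    show "(q has_field_derivative p' x - m * x) (at x within ?A)"
      using \<open>\<bar>x\<bar> < \<delta>\<close> by (auto intro!: has_field_derivative_at_within[OF dq])
  qed (use \<open>\<bar>x\<bar> < \<delta>\<close> in auto)
  then show ?thesis by (simp add: q_def power2_eq_square algebra_simps)
qed

theorem proposition1p3:
  fixes f :: "real \<times> real \<Rightarrow> real" and C :: real
  assumes "C2_on_square f"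
    and "partial_x f (0, 0) = 0" and "partial_y f (0, 0) = 0"
    and "\<not> (\<lambda>y. f (0, y)) constant_on {-1..1}"
    and "\<not> (\<lambda>x. f (x, 0)) constant_on {-1..1}"
    and "\<And>x y. x \<in> {-1..1} \<Longrightarrow> y \<in> {-1..1} \<Longrightarrow>
           f (x, y) - (INF x'\<in>{-1..1}. f (x', y)) \<le> C * \<bar>partial_x f (x, y)\<bar>\<^sup>2"
    and "\<And>x y. x \<in> {-1..1} \<Longrightarrow> y \<in> {-1..1} \<Longrightarrow>
           (SUP y'\<in>{-1..1}. f (x, y')) - f (x, y) \<le> C * \<bar>partial_y f (x, y)\<bar>\<^sup>2"
  shows "\<exists>r>0. \<forall>z0\<in>ball 0 r. \<exists>z.
           gda_flow f z0 z \<and>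
           (\<forall>w. gda_flow f z0 w \<longrightarrow> (\<forall>t\<ge>0. w t = z t)) \<and>
           (z \<longlongrightarrow> 0) at_top"
proof -
  \<comment> \<open>Throughout, \<open>y\<close> is treated like \<open>x\<close> by passing to \<open>- f\<close>, which turns suprema into infima.\<close>
  let ?I = "{-1..1} :: real set"
  let ?fx = "partial_x f" and ?fy = "partial_y f"
  let ?fxx = "partial_x ?fx" and ?fyy = "partial_y ?fy"
  let ?F = "\<lambda>z. (- ?fx z, ?fy z)"
  have C1: "C1_on_square f" "C1_on_square ?fx" "C1_on_square ?fy"
    using assms(1) by (auto simp: C2_on_square_def)
  have cont: "continuous_on unit_square ?fxx" "continuous_on unit_square ?fyy"
    using C1 by (auto simp: C1_on_square_def)
  have dx: "((\<lambda>s. f (s, y)) has_real_derivative ?fx (x, y)) (at x within ?I)"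
    and dxx: "((\<lambda>s. ?fx (s, y)) has_real_derivative ?fxx (x, y)) (at x within ?I)"
    and dy: "((\<lambda>s. - f (x, s)) has_real_derivative - ?fy (x, y)) (at y within ?I)"
    and dyy: "((\<lambda>s. - ?fy (x, s)) has_real_derivative - ?fyy (x, y)) (at y within ?I)"
    if "x \<in> ?I" "y \<in> ?I" for x y
    by (rule partial_x_has_derivative[OF C1(1) that] partial_x_has_derivative[OF C1(2) that]
        DERIV_minus[OF partial_y_has_derivative[OF C1(1) that]]
        DERIV_minus[OF partial_y_has_derivative[OF C1(3) that]])+
  have PLx: "f (x, 0) - (INF x'\<in>?I. f (x', 0)) \<le> C * (?fx (x, 0))\<^sup>2" if "x \<in> ?I" for x
    using assms(6)[OF that, of 0] by simp
  have PLy: "- f (0, y) - (INF y'\<in>?I. - f (0, y')) \<le> C * (- ?fy (0, y))\<^sup>2" if "y \<in> ?I" for y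
    using assms(7)[OF _ that, of 0] by (simp add: Inf_real_def image_image)
  have min_x: "f (0, 0) \<le> f (x, 0)" if "x \<in> ?I" for x
  proof -
    have "continuous_on ?I (\<lambda>x. f (x, 0))"
      using dx[of _ 0] by (intro DERIV_continuous_on) auto
    then show ?thesis
      using assms(2) PLx that
      by (intro PL_critical_point_is_minimum(1)[of "\<lambda>x. f (x, 0)" "\<lambda>x. ?fx (x, 0)" C x]) auto
  qed
  have max_y: "f (0, y) \<le> f (0, 0)" if "y \<in> ?I" for y
  proof -
    have "continuous_on ?I (\<lambda>y. - f (0, y))"
      using dy[of 0] by (intro DERIV_continuous_on) auto
    then have "- f (0, 0) \<le> - f (0, y)"
      using assms(3) PLy that
      by (intro PL_critical_point_is_minimum(1)[of "\<lambda>y. - f (0, y)" "\<lambda>y. - ?fy (0, y)" C y]) auto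
    then show ?thesis by simp
  qed
  have "?fxx (0, 0) > 0"
  proof (rule PL_critical_point_nondegenerate
      [of "\<lambda>x. f (x, 0)" "\<lambda>x. ?fx (x, 0)" "\<lambda>x. ?fxx (x, 0)" C])
    show "continuous_on ?I (\<lambda>x. ?fxx (x, 0))"
      by (rule continuous_on_compose2[OF cont(1)])
        (auto intro!: continuous_intros simp: unit_square_def)
  qed (use dx dxx PLx assms in auto)
  moreover have "- ?fyy (0, 0) > 0"
  proof (rule PL_critical_point_nondegenerate
      [of "\<lambda>y. - f (0, y)" "\<lambda>y. - ?fy (0, y)" "\<lambda>y. - ?fyy (0, y)" C])
    show "continuous_on ?I (\<lambda>y. - ?fyy (0, y))"
      by (intro continuous_intros continuous_on_compose2[OF cont(2)])
        (auto intro!: continuous_intros simp: unit_square_def)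
    show "\<not> (\<lambda>y. - f (0, y)) constant_on ?I"
      using assms(4) unfolding constant_on_def by (metis minus_equation_iff)
  qed (use dy dyy PLy assms in auto)
  ultimately obtain m where m: "m > 0" "m < ?fxx (0, 0)" "m < - ?fyy (0, 0)"
    using field_lbound_gt_zero[of "?fxx (0, 0)" "- ?fyy (0, 0)"] by blast
  obtain \<delta> where "0 < \<delta>" "\<delta> \<le> 1"
    and \<delta>: "\<And>x y. \<bar>x\<bar> < \<delta> \<Longrightarrow> \<bar>y\<bar> < \<delta> \<Longrightarrow> ?fxx (x, y) \<ge> m \<and> - ?fyy (x, y) \<ge> m"
  proof -
    have "(0, 0) \<in> unit_square" by (simp add: unit_square_def)
    moreover have "?fxx (0, 0) - m > 0" "- ?fyy (0, 0) - m > 0" using m by auto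
    ultimately obtain d1 d2 where d1: "d1 > 0" "\<forall>p\<in>unit_square. dist p (0, 0) < d1 \<longrightarrow>
          dist (?fxx p) (?fxx (0, 0)) < ?fxx (0, 0) - m"
      and d2: "d2 > 0" "\<forall>p\<in>unit_square. dist p (0, 0) < d2 \<longrightarrow>
          dist (?fyy p) (?fyy (0, 0)) < - ?fyy (0, 0) - m"
      using cont unfolding continuous_on_iff by blast
    \<comment> \<open>Half of the radii: the square with half-side \<open>\<delta>\<close> lies in both discs, as \<open>|(x, y)| \<le> |x| + |y|\<close>.\<close>
    define \<delta> where "\<delta> = min 1 (min d1 d2 / 2)"
    show ?thesis
    proof (rule that[of \<delta>])
      show "0 < \<delta>" "\<delta> \<le> 1" using d1 d2 by (auto simp: \<delta>_def)
      fix x y :: real assume xy: "\<bar>x\<bar> < \<delta>" "\<bar>y\<bar> < \<delta>"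
      have "norm (x, y) \<le> \<bar>x\<bar> + \<bar>y\<bar>" using norm_Pair_le[of x y] by simp
      with xy have "dist (x, y) (0, 0) < d1" "dist (x, y) (0, 0) < d2"
        by (auto simp: dist_norm \<delta>_def)
      moreover have "(x, y) \<in> unit_square"
        using xy by (auto simp: unit_square_def \<delta>_def)
      ultimately show "?fxx (x, y) \<ge> m \<and> - ?fyy (x, y) \<ge> m"
        using d1(2)[rule_format, of "(x, y)"] d2(2)[rule_format, of "(x, y)"] by (auto simp: dist_real_def)
    qed
  qed
  have interior: "\<bar>s\<bar> < \<delta> \<Longrightarrow> s \<in> ?I \<and> at s within ?I = at s" for s
    using \<open>\<delta> \<le> 1\<close> by (auto intro!: at_within_Icc_at)
  have dissipative: "z \<bullet> ?F z \<le> - (m / 2) * (norm z)\<^sup>2" if "z \<in> cball 0 (\<delta> / 2)" for z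
  proof -
    obtain x y where [simp]: "z = (x, y)" by fastforce
    have "\<bar>x\<bar> \<le> norm z" "\<bar>y\<bar> \<le> norm z"
      using norm_fst_le[of x y] norm_snd_le[of y x] by auto
    moreover have "norm z < \<delta>" using that \<open>0 < \<delta>\<close> by simp
    ultimately have xy: "\<bar>x\<bar> < \<delta>" "\<bar>y\<bar> < \<delta>" by auto
    \<comment> \<open>The square with half-side \<open>\<delta>\<close> contains the segments from \<open>(x, y)\<close> to both axes.\<close>
    note I = interior[OF xy(1)] interior[OF xy(2)]
    have "f (x, y) - f (0, y) + m / 2 * x\<^sup>2 \<le> x * ?fx (x, y)"
    proof (rule strong_convexity_tangent_bound
        [of \<delta> "\<lambda>s. f (s, y)" "\<lambda>s. ?fx (s, y)" "\<lambda>s. ?fxx (s, y)" m x, OF _ _ _ xy(1)])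
      fix s :: real assume s: "\<bar>s\<bar> < \<delta>"
      show "DERIV (\<lambda>s. f (s, y)) s :> ?fx (s, y)" "DERIV (\<lambda>s. ?fx (s, y)) s :> ?fxx (s, y)"
        using dx[of s y] dxx[of s y] interior[OF s] I by auto
      show "?fxx (s, y) \<ge> m" using \<delta>[OF s xy(2)] by simp
    qed
    moreover have "- f (x, y) - - f (x, 0) + m / 2 * y\<^sup>2 \<le> y * - ?fy (x, y)"
    proof (rule strong_convexity_tangent_bound
        [of \<delta> "\<lambda>s. - f (x, s)" "\<lambda>s. - ?fy (x, s)" "\<lambda>s. - ?fyy (x, s)" m y, OF _ _ _ xy(2)])
      fix s :: real assume s: "\<bar>s\<bar> < \<delta>"
      show "DERIV (\<lambda>s. - f (x, s)) s :> - ?fy (x, s)" "DERIV (\<lambda>s. - ?fy (x, s)) s :> - ?fyy (x, s)"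
        using dy[of x s] dyy[of x s] interior[OF s] I by auto
      show "- ?fyy (x, s) \<ge> m" using \<delta>[OF xy(1) s] by simp
    qed
    moreover have "f (0, y) \<le> f (x, 0)"
      using max_y[of y] min_x[of x] I by auto
    moreover have "(norm z)\<^sup>2 = x\<^sup>2 + y\<^sup>2" by (simp add: norm_Pair)
    ultimately show ?thesis by (simp add: algebra_simps)
  qed
  obtain L where lip: "L-lipschitz_on unit_square ?F"
  proof -
    obtain A B where lips: "A-lipschitz_on unit_square ?fx" "B-lipschitz_on unit_square ?fy"
      using C1 C1_on_square_imp_lipschitz by meson
    show ?thesis
      by (rule that[OF lipschitz_on_Pair[OF lipschitz_on_minus[OF lips(1)] lips(2)]])
  qed
  have sub: "cball 0 (\<delta> / 2) \<subseteq> unit_square"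
  proof
    fix z :: "real \<times> real" assume "z \<in> cball 0 (\<delta> / 2)"
    then have "norm z \<le> 1" using \<open>\<delta> \<le> 1\<close> \<open>0 < \<delta>\<close> by simp
    moreover have "\<bar>fst z\<bar> \<le> norm z" "\<bar>snd z\<bar> \<le> norm z"
      using norm_fst_le[of "fst z" "snd z"] norm_snd_le[of "snd z" "fst z"] by auto
    ultimately have "\<bar>fst z\<bar> \<le> 1" "\<bar>snd z\<bar> \<le> 1" by linarith+
    then show "z \<in> unit_square"
      by (simp add: unit_square_def mem_Times_iff abs_le_iff)
  qed
  have "\<exists>z. gda_flow f z0 z \<and> (\<forall>w. gda_flow f z0 w \<longrightarrow> (\<forall>t\<ge>0. w t = z t)) \<and> (z \<longlongrightarrow> 0) at_top"
    if "z0 \<in> ball 0 (\<delta> / 2)" for z0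
  proof -
    have "z0 \<in> cball 0 (\<delta> / 2)" using that by simp
    moreover have "0 < \<delta> / 2" "0 < m / 2" using \<open>0 < \<delta>\<close> \<open>m > 0\<close> by auto
    ultimately obtain z where z: "z 0 = z0" "(z \<longlongrightarrow> 0) at_top"
      "\<forall>t\<ge>0. z t \<in> cball 0 (\<delta> / 2) \<and> (z has_vector_derivative ?F (z t)) (at t within {0..})"
      using dissipative_flow_converges[OF _ _ lipschitz_on_subset[OF lip sub] dissipative] by blast
    then have flow: "gda_flow f z0 z" using sub unfolding gda_flow_def by blast
    moreover have "w t = z t" if "gda_flow f z0 w" "t \<ge> 0" for w t
    proof (rule lipschitz_flow_unique[OF lip, of z w t])
      show "w 0 = z 0" "t \<ge> 0" using that flow by (simp_all add: gda_flow_def)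
    qed (use that flow in \<open>unfold gda_flow_def, blast+\<close>)
    ultimately show ?thesis using z by blast
  qed
  with \<open>0 < \<delta>\<close> show ?thesis by (intro exI[of _ "\<delta> / 2"]) auto
qed

end
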